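(* Let $F\in C^2(\Omega)$ and let $u\in C^4([t_0,T])$ be the unique solution of $u'(t)=F(t,u(t))$, $t\in(t_0,T)$, $u(t_0)=u_0$. Suppose that there exist constants $\rho>0$ and $L\ge0$ such that $U_\rho(u)\subset\Omega$ and $|F(t,x)-F(t,y)|\le L|x-y|$ whenever $(t,x),(t,y)\in U_\rho(u)$. Suppose further that $$F(t,u(t))\,\mathcal{L}_FF(t,u(t))\ne0\qquad\text{and}\qquad 3\bigl(\mathcal{L}_FF(t,u(t))\bigr)^2=F(t,u(t))\,\mathcal{L}_F^2F(t,u(t))$$ for every $t\in[t_0,T]$. Suppose that there exist constants $C>0$ and $\varepsilon>0$ such that, for every $h\in(0,\varepsilon]$, a sequence of positive scales $\{\sigma_n\}_{n=0}^{N_h-1}$ is chosen and satisfies $\sigma_n\le C\sqrt{h}$ for $n=0,1,\ldots,N_h-1$. Then there exist constants $H>0$ and $C_g>0$ such that, for every $h\in(0,H]$, there exists a unique sequence $\{u_n\}_{n=0}^{N_h}$ with $u_0=u(t_0)$ satisfying $$u_{n+1}=u_n+h\,\mathcal{C}_{\sigma_n}\bigl(F(t_{n+1},u_{n+1}),F(t_n,u_n)\bigr),\qquad n=0,1,\ldots,N_h-1,$$ with $\{(t_n,u_n)\}_{n=0}^{N_h}\subseteq U_\rho(u)$, and the estimate $$\max_{0\le n\le N_h}|u(t_n)-u_n|\le C_gh^3$$ holds.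
   Context: Let $\Omega\subset\mathbb{R}^2$ be open, $F:\Omega\to\mathbb{R}$, $t_0\ge 0$, $T>t_0$, $u_0\in\mathbb{R}$ with $(t_0,u_0)\in\Omega$. A solution $u:[t_0,T]\to\mathbb{R}$ satisfies $(t,u(t))\in\Omega$ for every $t\in[t_0,T]$. For $\rho>0$, $U_\rho(u):=\{(t,x)\in[t_0,T]\times\mathbb{R}: |x-u(t)|\le\rho\}$. For $h>0$ put $N_h:=\lfloor h^{-1}(T-t_0)\rfloor$ and $t_n:=t_0+nh$. For $G\in C^1(\Omega)$, $\mathcal{L}_FG:=G_t+FG_x$; for $G\in C^2(\Omega)$, $\mathcal{L}_F^2G:=\mathcal{L}_F(\mathcal{L}_FG)$. For $\sigma>0$ define $\mathcal{C}_\sigma(\alpha,\beta):=\sigma\,\mathcal{C}(\alpha/\sigma,\beta/\sigma)$, where $$\mathcal{C}(\alpha,\beta):=\left(\frac{\alpha}{\sqrt{1+\alpha^2}}+\frac{\beta}{\sqrt{1+\beta^2}}\right)\left(\frac{1}{\sqrt{1+\alpha^2}}+\frac{1}{\sqrt{1+\beta^2}}\right)^{-1}.$$ *)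

theory Defs
  imports "HOL-Analysis.Analysis"
begin

definition partial_t :: "(real \<times> real \<Rightarrow> real) \<Rightarrow> real \<times> real \<Rightarrow> real" where
  "partial_t G p = deriv (\<lambda>s. G (s, snd p)) (fst p)"

definition partial_x :: "(real \<times> real \<Rightarrow> real) \<Rightarrow> real \<times> real \<Rightarrow> real" where
  "partial_x G p = deriv (\<lambda>y. G (fst p, y)) (snd p)"

(* G is of class C^k on the (open) set S: all partial derivatives up to order k exist and are
   continuous on S. *)
fun C_k_on :: "nat \<Rightarrow> (real \<times> real) set \<Rightarrow> (real \<times> real \<Rightarrow> real) \<Rightarrow> bool" where
  "C_k_on 0 S G \<longleftrightarrow> continuous_on S G"
| "C_k_on (Suc k) S G \<longleftrightarrow> continuous_on S G \<and>
     (\<forall>(t, x)\<in>S. (\<lambda>s. G (s, x)) field_differentiable at t \<and>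
                 (\<lambda>y. G (t, y)) field_differentiable at x) \<and>
     C_k_on k S (partial_t G) \<and> C_k_on k S (partial_x G)"

(* f is of class C^k on [a, b], with one-sided derivatives at the end points. *)
fun C_k_interval :: "nat \<Rightarrow> real \<Rightarrow> real \<Rightarrow> (real \<Rightarrow> real) \<Rightarrow> bool" where
  "C_k_interval 0 a b f \<longleftrightarrow> continuous_on {a..b} f"
| "C_k_interval (Suc k) a b f \<longleftrightarrow>
     (\<exists>f'. (\<forall>t\<in>{a..b}. (f has_real_derivative f' t) (at t within {a..b})) \<and>
           C_k_interval k a b f')"

definition lie_deriv ::
    "(real \<times> real \<Rightarrow> real) \<Rightarrow> (real \<times> real \<Rightarrow> real) \<Rightarrow> real \<times> real \<Rightarrow> real" where
  "lie_deriv F G p = partial_t G p + F p * partial_x G p"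

(* The differential equation is required on the open interval only; continuity on [t0, T]
   ties the values at the end points to the interior. *)
definition ivp_solution ::
    "(real \<times> real) set \<Rightarrow> (real \<times> real \<Rightarrow> real) \<Rightarrow> real \<Rightarrow> real \<Rightarrow> real \<Rightarrow> (real \<Rightarrow> real) \<Rightarrow> bool" where
  "ivp_solution \<Omega> F t0 T u0 u \<longleftrightarrow>
     continuous_on {t0..T} u \<and> (\<forall>t\<in>{t0..T}. (t, u t) \<in> \<Omega>) \<and>
     (\<forall>t\<in>{t0<..<T}. (u has_real_derivative F (t, u t)) (at t)) \<and> u t0 = u0"

definition tube :: "real \<Rightarrow> real \<Rightarrow> real \<Rightarrow> (real \<Rightarrow> real) \<Rightarrow> (real \<times> real) set" where
  "tube t0 T \<rho> u = {(t, x). t \<in> {t0..T} \<and> \<bar>x - u t\<bar> \<le> \<rho>}"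

definition num_steps :: "real \<Rightarrow> real \<Rightarrow> real \<Rightarrow> nat" where
  "num_steps t0 T h = nat \<lfloor>inverse h * (T - t0)\<rfloor>"

definition grid :: "real \<Rightarrow> real \<Rightarrow> nat \<Rightarrow> real" where
  "grid t0 h n = t0 + real n * h"

definition circ_mean :: "real \<Rightarrow> real \<Rightarrow> real" where
  "circ_mean \<alpha> \<beta> =
     (\<alpha> / sqrt (1 + \<alpha>\<^sup>2) + \<beta> / sqrt (1 + \<beta>\<^sup>2)) *
     inverse (1 / sqrt (1 + \<alpha>\<^sup>2) + 1 / sqrt (1 + \<beta>\<^sup>2))"

definition scaled_circ_mean :: "real \<Rightarrow> real \<Rightarrow> real \<Rightarrow> real" where
  "scaled_circ_mean \<sigma> \<alpha> \<beta> = \<sigma> * circ_mean (\<alpha> / \<sigma>) (\<beta> / \<sigma>)"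

(* Only the entries v 0, ..., v (num_steps t0 T h) are constrained; they form the finite
   sequence of the scheme. *)
definition scheme_solution ::
    "(real \<times> real \<Rightarrow> real) \<Rightarrow> real \<Rightarrow> real \<Rightarrow> real \<Rightarrow> (nat \<Rightarrow> real) \<Rightarrow> real \<Rightarrow> (nat \<Rightarrow> real) \<Rightarrow> bool"
  where
  "scheme_solution F t0 T h s y0 v \<longleftrightarrow>
     v 0 = y0 \<and>
     (\<forall>n<num_steps t0 T h.
        v (Suc n) = v n + h * scaled_circ_mean (s n)
          (F (grid t0 h (Suc n), v (Suc n))) (F (grid t0 h n, v n)))"

end

theory Submission
  imports Defs
begin

text \<open>
  Clearing denominators, the scaled mean is
  \<open>(\<alpha> s + \<beta> r) / (r + s)\<close> with \<open>r = sqrt (\<sigma>\<^sup>2 + \<alpha>\<^sup>2)\<close> and \<open>s = sqrt (\<sigma>\<^sup>2 + \<beta>\<^sup>2)\<close>.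
  It is 2-Lipschitz in each argument uniformly in \<open>\<sigma>\<close>, and for \<open>\<alpha>\<close>, \<open>\<beta>\<close> of the same sign and
  bounded away from zero it differs from their harmonic mean by \<open>O(\<sigma>\<^sup>2 (\<alpha> - \<beta>)\<^sup>2)\<close>. Along the
  solution, with \<open>\<phi> = u'\<close>, the third-order condition \<open>3 \<phi>'\<^sup>2 = \<phi> \<phi>''\<close> says that \<open>\<phi>' / \<phi>\<^sup>3\<close> is a
  constant \<open>k\<close>; then \<open>1 / \<phi>\<^sup>2 + 2 k t\<close> and \<open>u + 1 / (k \<phi>)\<close> are constant, and from these two
  first integrals the harmonic mean scheme reproduces \<open>u\<close> exactly. Since \<open>\<sigma> = O(sqrt h)\<close>, the
  local error of the actual scheme is \<open>O(h\<^sup>4)\<close>, and the Lipschitz bound turns this into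
  existence, uniqueness and a global error \<open>O(h\<^sup>3)\<close> by contraction and a discrete Gronwall
  argument.
\<close>

section \<open>The scaled mean\<close>

text \<open>No quotient by \<sigma> remains on the right, which is what makes bounds uniform in
  \<sigma> possible.\<close>

lemma scaled_circ_mean_eq:
  assumes "\<sigma> > 0"
  shows "scaled_circ_mean \<sigma> \<alpha> \<beta> =
    (\<alpha> * sqrt (\<sigma>\<^sup>2 + \<beta>\<^sup>2) + \<beta> * sqrt (\<sigma>\<^sup>2 + \<alpha>\<^sup>2)) / (sqrt (\<sigma>\<^sup>2 + \<alpha>\<^sup>2) + sqrt (\<sigma>\<^sup>2 + \<beta>\<^sup>2))"
proof -
  have root: "sqrt (1 + (x / \<sigma>)\<^sup>2) = sqrt (\<sigma>\<^sup>2 + x\<^sup>2) / \<sigma>" for x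
  proof -
    have "1 + (x / \<sigma>)\<^sup>2 = (\<sigma>\<^sup>2 + x\<^sup>2) / \<sigma>\<^sup>2"
      using assms by (simp add: field_simps power2_eq_square)
    then show ?thesis
      using assms by (simp add: real_sqrt_divide)
  qed
  have pos: "sqrt (\<sigma>\<^sup>2 + x\<^sup>2) > 0" for x
    using assms by (simp add: add_pos_nonneg)
  \<comment> \<open>Stated for arbitrary positive \<open>r\<close> and \<open>s\<close>, so that the
    field arithmetic never meets the square roots.\<close>
  have "\<sigma> * ((\<alpha> / \<sigma> / (r / \<sigma>) + \<beta> / \<sigma> / (s / \<sigma>)) * inverse (1 / (r / \<sigma>) + 1 / (s / \<sigma>))) =
      (\<alpha> * s + \<beta> * r) / (r + s)" if "r > 0" "s > 0" for r s
  proof -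
    have "1 / (r / \<sigma>) + 1 / (s / \<sigma>) = \<sigma> * (r + s) / (r * s)"
      "\<alpha> / \<sigma> / (r / \<sigma>) + \<beta> / \<sigma> / (s / \<sigma>) = (\<alpha> * s + \<beta> * r) / (r * s)"
      using that assms by (simp_all add: field_simps)
    then show ?thesis
      using that assms by simp
  qed
  then show ?thesis
    using pos unfolding scaled_circ_mean_def circ_mean_def root by blast
qed

lemma scaled_circ_mean_commute: "scaled_circ_mean \<sigma> \<alpha> \<beta> = scaled_circ_mean \<sigma> \<beta> \<alpha>"
  by (simp add: scaled_circ_mean_def circ_mean_def add.commute)

text \<open>\<open>sqrt (\<sigma>\<^sup>2 + x\<^sup>2)\<close> is the modulus of
  \<open>Complex \<sigma> x\<close>, so this is the reverse triangle inequality in the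
  plane.\<close>

lemma sqrt_add_power2_lipschitz: "\<bar>sqrt (\<sigma>\<^sup>2 + x\<^sup>2) - sqrt (\<sigma>\<^sup>2 + y\<^sup>2)\<bar> \<le> \<bar>x - y\<bar>"
  using norm_triangle_ineq3[of "Complex \<sigma> x" "Complex \<sigma> y"]
  by (simp add: complex_norm minus_complex.code)

text \<open>One copy of \<open>\<bar>\<alpha> - \<alpha>'\<bar>\<close> comes from \<alpha> itself,
  the other from the weight \<open>r\<close> that depends on it. The constant must not involve
  \<sigma>, since the scales are bounded only from above and may be arbitrarily small.\<close>

lemma scaled_circ_mean_lipschitz_left:
  assumes "\<sigma> > 0"
  shows "\<bar>scaled_circ_mean \<sigma> \<alpha> \<beta> - scaled_circ_mean \<sigma> \<alpha>' \<beta>\<bar> \<le> 2 * \<bar>\<alpha> - \<alpha>'\<bar>"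
proof -
  define r where "r = sqrt (\<sigma>\<^sup>2 + \<alpha>\<^sup>2)"
  define r' where "r' = sqrt (\<sigma>\<^sup>2 + \<alpha>'\<^sup>2)"
  define s where "s = sqrt (\<sigma>\<^sup>2 + \<beta>\<^sup>2)"
  have pos: "r > 0" "r' > 0" "s > 0"
    using assms by (simp_all add: r_def r'_def s_def add_pos_nonneg)
  have "\<bar>\<alpha>'\<bar> \<le> r'" "\<bar>\<beta>\<bar> \<le> s"
    by (simp_all add: r'_def s_def real_le_rsqrt)
  then have diff: "\<bar>\<alpha>' - \<beta>\<bar> \<le> r' + s"
    by linarith
  have rr: "\<bar>r' - r\<bar> \<le> \<bar>\<alpha> - \<alpha>'\<bar>"
    using sqrt_add_power2_lipschitz[of \<sigma> \<alpha> \<alpha>'] by (simp add: r_def r'_def abs_minus_commute)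
  \<comment> \<open>The difference factors exactly. The outer quotient is at most 1, and so is the
    inner one because \<open>r'\<close> and \<open>s\<close> dominate
    \<open>\<bar>\<alpha>'\<bar>\<close> and \<open>\<bar>\<beta>\<bar>\<close>.\<close>
  have eq: "(\<alpha> * s + \<beta> * r) / (r + s) - (\<alpha>' * s + \<beta> * r') / (r' + s) =
      s / (r + s) * ((\<alpha> - \<alpha>') + (r' - r) * ((\<alpha>' - \<beta>) / (r' + s)))"
    using pos by (simp add: divide_simps add_pos_pos less_imp_neq[symmetric]) (simp add: algebra_simps)
  have "\<bar>(\<alpha>' - \<beta>) / (r' + s)\<bar> \<le> 1"
    using diff pos by (simp add: divide_le_eq)
  then have "\<bar>r' - r\<bar> * \<bar>(\<alpha>' - \<beta>) / (r' + s)\<bar> \<le> \<bar>\<alpha> - \<alpha>'\<bar> * 1"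
    using rr by (intro mult_mono) auto
  then have "\<bar>\<alpha> - \<alpha>'\<bar> + \<bar>(r' - r) * ((\<alpha>' - \<beta>) / (r' + s))\<bar> \<le> \<bar>\<alpha> - \<alpha>'\<bar> + \<bar>\<alpha> - \<alpha>'\<bar>"
    unfolding abs_mult by (intro add_left_mono) simp
  then have "\<bar>(\<alpha> - \<alpha>') + (r' - r) * ((\<alpha>' - \<beta>) / (r' + s))\<bar> \<le> 2 * \<bar>\<alpha> - \<alpha>'\<bar>"
    unfolding mult_2 by (rule order_trans[OF abs_triangle_ineq])
  moreover have "\<bar>s / (r + s)\<bar> \<le> 1"
    using pos by (simp add: divide_le_eq)
  ultimately have "\<bar>s / (r + s)\<bar> * \<bar>(\<alpha> - \<alpha>') + (r' - r) * ((\<alpha>' - \<beta>) / (r' + s))\<bar> \<le> 1 * (2 * \<bar>\<alpha> - \<alpha>'\<bar>)"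
    by (intro mult_mono) auto
  then show ?thesis
    unfolding scaled_circ_mean_eq[OF assms] r_def[symmetric] r'_def[symmetric] s_def[symmetric] eq
    by (simp add: abs_mult)
qed

lemma scaled_circ_mean_lipschitz:
  assumes "\<sigma> > 0"
  shows "\<bar>scaled_circ_mean \<sigma> \<alpha> \<beta> - scaled_circ_mean \<sigma> \<alpha>' \<beta>'\<bar> \<le> 2 * (\<bar>\<alpha> - \<alpha>'\<bar> + \<bar>\<beta> - \<beta>'\<bar>)"
  using scaled_circ_mean_lipschitz_left[OF assms, of \<alpha> \<beta> \<alpha>']
    scaled_circ_mean_lipschitz_left[OF assms, of \<beta> \<alpha>' \<beta>']
    scaled_circ_mean_commute[of \<sigma> \<alpha>'] by (simp add: algebra_simps)

text \<open>At \<sigma> = 0 the weights become the absolute values of \<alpha> and \<beta>, and for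
  equal signs the mean becomes the harmonic one. One factor \<alpha> - \<beta> appears when the two
  fractions are subtracted; the other, together with \<open>\<sigma>\<^sup>2\<close>, comes from
  \<open>s * \<alpha> - r * \<beta>\<close>.\<close>

lemma scaled_circ_mean_harmonic_mean:
  assumes "\<sigma> > 0" "m > 0" "m \<le> \<bar>\<alpha>\<bar>" "m \<le> \<bar>\<beta>\<bar>" "\<alpha> * \<beta> > 0"
  shows "\<bar>scaled_circ_mean \<sigma> \<alpha> \<beta> - 2 * \<alpha> * \<beta> / (\<alpha> + \<beta>)\<bar> \<le> \<sigma>\<^sup>2 * (\<alpha> - \<beta>)\<^sup>2 / (4 * m ^ 3)"
proof -
  define r where "r = sqrt (\<sigma>\<^sup>2 + \<alpha>\<^sup>2)"
  define s where "s = sqrt (\<sigma>\<^sup>2 + \<beta>\<^sup>2)"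
  have sq: "r\<^sup>2 = \<sigma>\<^sup>2 + \<alpha>\<^sup>2" "s\<^sup>2 = \<sigma>\<^sup>2 + \<beta>\<^sup>2"
    by (simp_all add: r_def s_def)
  have "\<bar>\<alpha>\<bar> \<le> r" "\<bar>\<beta>\<bar> \<le> s"
    by (simp_all add: r_def s_def real_le_rsqrt)
  then have ge: "m \<le> r" "m \<le> s"
    using assms by linarith+
  have abs_add: "\<bar>x + y\<bar> = \<bar>x\<bar> + \<bar>y\<bar>" if "0 \<le> x * y" for x y :: real
    using that by (auto simp: zero_le_mult_iff)
  have nz: "\<alpha> + \<beta> \<noteq> 0"
    using abs_add[OF less_imp_le[OF \<open>\<alpha> * \<beta> > 0\<close>]] assms by linarith
  \<comment> \<open>Equal signs prevent cancellation in \<open>s * \<alpha> + r * \<beta>\<close>,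
    which bounds this later denominator from below.\<close>
  have "0 \<le> (s * r) * (\<alpha> * \<beta>)"
    using \<open>\<alpha> * \<beta> > 0\<close> ge \<open>m > 0\<close> by (intro mult_nonneg_nonneg less_imp_le[of 0 "\<alpha> * \<beta>"]) auto
  then have "0 \<le> (s * \<alpha>) * (r * \<beta>)"
    by (simp add: mult_ac)
  then have "\<bar>s * \<alpha> + r * \<beta>\<bar> = \<bar>s * \<alpha>\<bar> + \<bar>r * \<beta>\<bar>"
    by (rule abs_add)
  also have "\<dots> = s * \<bar>\<alpha>\<bar> + r * \<bar>\<beta>\<bar>"
    using ge \<open>m > 0\<close> by (simp add: abs_mult)
  also have "\<dots> \<ge> m * m + m * m"
    using assms ge by (intro add_mono mult_mono) auto
  finally have q: "2 * m\<^sup>2 \<le> \<bar>s * \<alpha> + r * \<beta>\<bar>"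
    by (simp add: power2_eq_square)
  then have q0: "s * \<alpha> + r * \<beta> \<noteq> 0"
    using zero_less_power[OF \<open>m > 0\<close>, of 2] by auto
  have rs: "r + s > 0"
    using ge \<open>m > 0\<close> by linarith
  have "(\<alpha> * s + \<beta> * r) / (r + s) - 2 * \<alpha> * \<beta> / (\<alpha> + \<beta>) = (s * \<alpha> - r * \<beta>) * (\<alpha> - \<beta>) / ((r + s) * (\<alpha> + \<beta>))"
    using rs nz by (simp add: divide_simps) (simp add: algebra_simps)
  \<comment> \<open>Multiplying by the conjugate \<open>s * \<alpha> + r * \<beta>\<close> removes
    the roots; the terms \<open>\<alpha>\<^sup>2 * \<beta>\<^sup>2\<close> cancel and
    \<open>\<sigma>\<^sup>2\<close> comes out.\<close>
  also have "s * \<alpha> - r * \<beta> = \<sigma>\<^sup>2 * (\<alpha> - \<beta>) * (\<alpha> + \<beta>) / (s * \<alpha> + r * \<beta>)"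
  proof -
    have "(s * \<alpha> - r * \<beta>) * (s * \<alpha> + r * \<beta>) = s\<^sup>2 * \<alpha>\<^sup>2 - r\<^sup>2 * \<beta>\<^sup>2"
      by (simp add: algebra_simps power2_eq_square)
    also have "\<dots> = \<sigma>\<^sup>2 * (\<alpha> - \<beta>) * (\<alpha> + \<beta>)"
      unfolding sq by (simp add: algebra_simps power2_eq_square)
    finally show ?thesis
      using q0 by (simp add: eq_divide_eq)
  qed
  also have "\<sigma>\<^sup>2 * (\<alpha> - \<beta>) * (\<alpha> + \<beta>) / (s * \<alpha> + r * \<beta>) * (\<alpha> - \<beta>) / ((r + s) * (\<alpha> + \<beta>)) =
      \<sigma>\<^sup>2 * (\<alpha> - \<beta>)\<^sup>2 / ((r + s) * (s * \<alpha> + r * \<beta>))"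
    using nz by (simp add: power2_eq_square mult_ac)
  finally have "\<bar>(\<alpha> * s + \<beta> * r) / (r + s) - 2 * \<alpha> * \<beta> / (\<alpha> + \<beta>)\<bar> =
      \<sigma>\<^sup>2 * (\<alpha> - \<beta>)\<^sup>2 / ((r + s) * \<bar>s * \<alpha> + r * \<beta>\<bar>)"
    using rs by (simp add: abs_mult)
  also have "\<dots> \<le> \<sigma>\<^sup>2 * (\<alpha> - \<beta>)\<^sup>2 / (4 * m ^ 3)"
  proof (rule divide_left_mono)
    have "(2 * m) * (2 * m\<^sup>2) \<le> (r + s) * \<bar>s * \<alpha> + r * \<beta>\<bar>"
      using ge q \<open>m > 0\<close> by (intro mult_mono) auto
    then show "4 * m ^ 3 \<le> (r + s) * \<bar>s * \<alpha> + r * \<beta>\<bar>"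
      by (simp add: power2_eq_square power3_eq_cube)
    show "0 < (r + s) * \<bar>s * \<alpha> + r * \<beta>\<bar> * (4 * m ^ 3)"
      using rs q0 \<open>m > 0\<close> by simp
  qed simp
  finally show ?thesis
    unfolding scaled_circ_mean_eq[OF \<open>\<sigma> > 0\<close>] r_def s_def .
qed

section \<open>Derivatives along a curve\<close>

lemma C_1_on_add:
  assumes "C_k_on 1 S f" "C_k_on 1 S g"
  shows "C_k_on 1 S (\<lambda>p. f p + g p)"
proof -
  have "partial_t (\<lambda>p. f p + g p) p = partial_t f p + partial_t g p"
    "partial_x (\<lambda>p. f p + g p) p = partial_x f p + partial_x g p" if "p \<in> S" for p
    using assms that by (auto simp: partial_t_def partial_x_def deriv_add split_beta)
  then show ?thesis
    using assms
    by (auto simp: split_beta intro!: continuous_intros derivative_intros cong: continuous_on_cong)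
qed

lemma C_1_on_mult:
  assumes "C_k_on 1 S f" "C_k_on 1 S g"
  shows "C_k_on 1 S (\<lambda>p. f p * g p)"
proof -
  have "partial_t (\<lambda>p. f p * g p) p = f p * partial_t g p + partial_t f p * g p"
    "partial_x (\<lambda>p. f p * g p) p = f p * partial_x g p + partial_x f p * g p" if "p \<in> S" for p
    using assms that by (auto simp: partial_t_def partial_x_def deriv_mult split_beta)
  then show ?thesis
    using assms
    by (auto simp: split_beta intro!: continuous_intros derivative_intros cong: continuous_on_cong)
qed

lemma C_1_on_lie_deriv:
  assumes "C_k_on 2 S F"
  shows "C_k_on 1 S (lie_deriv F F)"
proof -
  have "C_k_on 1 S F" "C_k_on 1 S (partial_t F)" "C_k_on 1 S (partial_x F)"
    using assms by (auto simp: numeral_2_eq_2)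
  then show ?thesis
    using C_1_on_add[OF _ C_1_on_mult] unfolding lie_deriv_def by blast
qed

text \<open>For use with a curve whose value may lie on either side of a base point or coincide with
  it; hence the closed bound on \<open>z\<close>.\<close>

lemma MVT_unordered:
  fixes f f' :: "real \<Rightarrow> real"
  assumes "\<And>z. \<bar>z - x\<bar> \<le> \<bar>y - x\<bar> \<Longrightarrow> (f has_real_derivative f' z) (at z)"
  shows "\<exists>z. \<bar>z - x\<bar> \<le> \<bar>y - x\<bar> \<and> f y - f x = (y - x) * f' z"
proof (cases rule: linorder_cases[of x y])
  case less
  then have "\<exists>z. x < z \<and> z < y \<and> f y - f x = (y - x) * f' z"
    by (intro MVT2 assms) auto
  then show ?thesis by force
next
  case equal
  then show ?thesis by auto
next
  case greater
  then have "\<exists>z. y < z \<and> z < x \<and> f x - f y = (x - y) * f' z"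
    by (intro MVT2 assms) auto
  then obtain z where "y < z" "z < x" "f x - f y = (x - y) * f' z"
    by blast
  then show ?thesis
    by (intro exI[of _ z]) (auto simp: algebra_simps)
qed

text \<open>\<open>C_k_on\<close> speaks of partial derivatives only, so the chain rule is derived
  from them. The increment is split at \<open>(s, u t)\<close>: the part in the first variable is a
  plain difference quotient, and the part in the second is rewritten by the mean value theorem and
  passes to the limit by continuity of \<open>partial_x G\<close>.\<close>

lemma C_1_on_derivative_along_curve:
  assumes "open S" "C_k_on 1 S G" "(t, u t) \<in> S" and u: "(u has_real_derivative u') (at t)"
  shows "((\<lambda>s. G (s, u s)) has_real_derivative
    partial_t G (t, u t) + u' * partial_x G (t, u t)) (at t)"
proof -
  define x where "x = u t"
  have part: "((\<lambda>s. G (s, y)) has_real_derivative partial_t G (s, y)) (at s)"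
    "((\<lambda>y. G (s, y)) has_real_derivative partial_x G (s, y)) (at y)" if "(s, y) \<in> S" for s y
    using assms(2) that
    by (auto simp: partial_t_def partial_x_def field_differentiable_derivI)
  \<comment> \<open>A product box inside \<open>S\<close> contains the whole vertical segment from
    \<open>(s, x)\<close> to \<open>(s, u s)\<close> once \<open>s\<close> is close to
    \<open>t\<close>.\<close>
  obtain A B where AB: "open A" "open B" "t \<in> A" "x \<in> B" "A \<times> B \<subseteq> S"
    using open_prod_elim[OF assms(1,3)] unfolding x_def by (metis mem_Sigma_iff)
  obtain e where e: "e > 0" "\<And>z. \<bar>z - x\<bar> < e \<Longrightarrow> z \<in> B"
    using AB(2,4) by (auto simp: open_dist dist_real_def)
  have "isCont u t"
    using u by (rule DERIV_isCont)
  then have lim_u: "(u \<longlongrightarrow> x) (at t)"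
    by (simp add: isCont_def x_def)
  have ev: "\<forall>\<^sub>F s in at t. s \<in> A \<and> \<bar>u s - x\<bar> < e"
    using tendstoD[OF lim_u e(1)] eventually_at_in_open'[OF AB(1,3)]
    by (auto elim: eventually_elim2 simp: dist_real_def)
  have "\<exists>z. \<bar>z - x\<bar> \<le> \<bar>u s - x\<bar> \<and> G (s, u s) - G (s, x) = (u s - x) * partial_x G (s, z)"
    if "s \<in> A \<and> \<bar>u s - x\<bar> < e" for s
    by (rule MVT_unordered) (use that e AB in \<open>auto intro!: part\<close>)
  then obtain \<xi> where \<xi>: "\<And>s. s \<in> A \<and> \<bar>u s - x\<bar> < e \<Longrightarrow> \<bar>\<xi> s - x\<bar> \<le> \<bar>u s - x\<bar> \<and>
      G (s, u s) - G (s, x) = (u s - x) * partial_x G (s, \<xi> s)"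
    by metis
  have "((\<lambda>s. \<xi> s - x) \<longlongrightarrow> 0) (at t)"
  proof (rule Lim_null_comparison)
    show "\<forall>\<^sub>F s in at t. norm (\<xi> s - x) \<le> \<bar>u s - x\<bar>"
      using ev by eventually_elim (use \<xi> in auto)
    show "((\<lambda>s. \<bar>u s - x\<bar>) \<longlongrightarrow> 0) (at t)"
      using tendsto_rabs[OF tendsto_diff[OF lim_u tendsto_const[of x]]] by simp
  qed
  then have "((\<lambda>s. (s, \<xi> s)) \<longlongrightarrow> (t, x)) (at t)"
    by (intro tendsto_Pair) (auto simp: LIM_zero_iff)
  moreover have "isCont (partial_x G) (t, x)"
    using assms(1-3) by (auto simp: continuous_on_eq_continuous_at x_def)
  ultimately have "((\<lambda>s. partial_x G (s, \<xi> s)) \<longlongrightarrow> partial_x G (t, x)) (at t)"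
    by (rule isCont_tendsto_compose[rotated])
  moreover have "((\<lambda>s. (u s - x) / (s - t)) \<longlongrightarrow> u') (at t)"
    "((\<lambda>s. (G (s, x) - G (t, x)) / (s - t)) \<longlongrightarrow> partial_t G (t, x)) (at t)"
    using u part(1)[of t x] assms(3) by (simp_all add: has_field_derivative_iff x_def)
  ultimately have "((\<lambda>s. (G (s, x) - G (t, x)) / (s - t) + (u s - x) / (s - t) * partial_x G (s, \<xi> s))
      \<longlongrightarrow> partial_t G (t, x) + u' * partial_x G (t, x)) (at t)"
    by (intro tendsto_intros)
  moreover have "\<forall>\<^sub>F s in at t. (G (s, x) - G (t, x)) / (s - t) + (u s - x) / (s - t) * partial_x G (s, \<xi> s)
      = (G (s, u s) - G (t, x)) / (s - t)"
    using ev
  proof eventually_elim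
    case (elim s)
    have "(u s - x) / (s - t) * partial_x G (s, \<xi> s) = (G (s, u s) - G (s, x)) / (s - t)"
      using \<xi>[OF elim] by simp
    then show ?case
      by (simp add: diff_divide_distrib)
  qed
  ultimately have "((\<lambda>s. (G (s, u s) - G (t, x)) / (s - t)) \<longlongrightarrow> partial_t G (t, x) + u' * partial_x G (t, x)) (at t)"
    by (simp cong: tendsto_cong)
  then show ?thesis
    by (simp add: has_field_derivative_iff x_def)
qed

section \<open>Exactness of the harmonic mean step\<close>

lemma continuous_nonzero_same_sign:
  fixes f :: "real \<Rightarrow> real"
  assumes "a \<le> b" "continuous_on {a..b} f" "\<And>x. x \<in> {a..b} \<Longrightarrow> f x \<noteq> 0"
  shows "f a * f b > 0"
proof (rule ccontr)
  assume "\<not> f a * f b > 0"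
  then have "f a \<le> 0 \<and> 0 \<le> f b \<or> f b \<le> 0 \<and> 0 \<le> f a"
    by (auto simp: zero_less_mult_iff not_less)
  then have "\<exists>x\<ge>a. x \<le> b \<and> f x = 0"
    using IVT'[of f a 0 b] IVT2'[of f b 0 a] assms(1,2) by blast
  then show False
    using assms(3) by auto
qed

text \<open>The equation \<open>\<psi> = k * \<phi> ^ 3\<close> is integrated twice, and both
  \<open>u b - u a\<close> and \<open>b - a\<close> become expressions in the end values of \<phi>
  alone; their quotient is the harmonic mean. Derivatives are asked for in the open interval only,
  as the differential equation supplies them there.\<close>

lemma harmonic_mean_step_exact:
  fixes u \<phi> \<psi> \<zeta> :: "real \<Rightarrow> real"
  assumes "a < b"
    and cont: "continuous_on {a..b} u" "continuous_on {a..b} \<phi>" "continuous_on {a..b} \<psi>"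
    and u: "\<And>t. a < t \<Longrightarrow> t < b \<Longrightarrow> (u has_real_derivative \<phi> t) (at t)"
    and \<phi>: "\<And>t. a < t \<Longrightarrow> t < b \<Longrightarrow> (\<phi> has_real_derivative \<psi> t) (at t)"
    and \<psi>: "\<And>t. a < t \<Longrightarrow> t < b \<Longrightarrow> (\<psi> has_real_derivative \<zeta> t) (at t)"
    and nz: "\<And>t. t \<in> {a..b} \<Longrightarrow> \<phi> t \<noteq> 0" "\<And>t. t \<in> {a..b} \<Longrightarrow> \<psi> t \<noteq> 0"
    and order3: "\<And>t. t \<in> {a..b} \<Longrightarrow> 3 * (\<psi> t)\<^sup>2 = \<phi> t * \<zeta> t"
  shows "u b - u a = (b - a) * (2 * \<phi> b * \<phi> a / (\<phi> b + \<phi> a))"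
proof -
  define k where "k = \<psi> a / \<phi> a ^ 3"
  have "k \<noteq> 0"
    using nz[of a] \<open>a < b\<close> by (simp add: k_def)
  have k: "\<psi> t = k * \<phi> t ^ 3" if "t \<in> {a..b}" for t
  proof -
    have "\<psi> t / \<phi> t ^ 3 = k"
      unfolding k_def
    proof (rule DERIV_isconst2[OF \<open>a < b\<close>])
      show "continuous_on {a..b} (\<lambda>t. \<psi> t / \<phi> t ^ 3)"
        using nz by (intro continuous_intros cont) auto
      fix t assume t: "a < t" "t < b"
      then have n: "\<phi> t \<noteq> 0" using nz by auto
      have "((\<lambda>t. \<psi> t / \<phi> t ^ 3) has_real_derivative
          (\<zeta> t * \<phi> t ^ 3 - \<psi> t * (3 * \<phi> t ^ 2 * \<psi> t)) / (\<phi> t ^ 3 * \<phi> t ^ 3)) (at t)"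
        by (rule derivative_eq_intros \<phi>[OF t] \<psi>[OF t] | use n in simp)+
      \<comment> \<open>The last factor is the order condition, so the quotient has derivative
        zero.\<close>
      moreover have "\<zeta> t * \<phi> t ^ 3 - \<psi> t * (3 * \<phi> t ^ 2 * \<psi> t) = \<phi> t ^ 2 * (\<phi> t * \<zeta> t - 3 * (\<psi> t)\<^sup>2)"
        by (simp add: algebra_simps power2_eq_square power3_eq_cube)
      ultimately show "((\<lambda>t. \<psi> t / \<phi> t ^ 3) has_real_derivative 0) (at t)"
        using order3[of t] t by simp
    qed (use that in auto)
    then show ?thesis
      using nz(1)[OF that] by (simp add: field_simps)
  qed
  \<comment> \<open>The derivative of \<open>1 / (k * \<phi>)\<close> is
    \<open>- \<psi> / (k * \<phi>\<^sup>2)\<close>, that is \<open>- \<phi>\<close>, which cancels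
    the derivative of \<open>u\<close>.\<close>
  have E1: "u b + 1 / (k * \<phi> b) = u a + 1 / (k * \<phi> a)"
  proof (rule DERIV_isconst_end[OF \<open>a < b\<close>])
    show "continuous_on {a..b} (\<lambda>t. u t + 1 / (k * \<phi> t))"
      using nz \<open>k \<noteq> 0\<close> by (intro continuous_intros cont) auto
    fix t assume t: "a < t" "t < b"
    then have n: "\<phi> t \<noteq> 0" using nz by auto
    have "((\<lambda>t. u t + 1 / (k * \<phi> t)) has_real_derivative \<phi> t - k * \<psi> t / (k * \<phi> t)\<^sup>2) (at t)"
      by (rule derivative_eq_intros u[OF t] \<phi>[OF t] refl | use n \<open>k \<noteq> 0\<close> in \<open>simp add: power2_eq_square\<close>)+
    moreover have "\<phi> t - k * \<psi> t / (k * \<phi> t)\<^sup>2 = 0"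
      using n \<open>k \<noteq> 0\<close> k[of t] t by (simp add: power2_eq_square power3_eq_cube)
    ultimately show "((\<lambda>t. u t + 1 / (k * \<phi> t)) has_real_derivative 0) (at t)"
      by simp
  qed
  \<comment> \<open>Here \<open>1 / \<phi>\<^sup>2\<close> has derivative
    \<open>- 2 * \<psi> / \<phi> ^ 3\<close>, the constant \<open>- 2 * k\<close>.\<close>
  have E2: "1 / (\<phi> b)\<^sup>2 + 2 * k * b = 1 / (\<phi> a)\<^sup>2 + 2 * k * a"
  proof (rule DERIV_isconst_end[OF \<open>a < b\<close>])
    show "continuous_on {a..b} (\<lambda>t. 1 / (\<phi> t)\<^sup>2 + 2 * k * t)"
      using nz \<open>k \<noteq> 0\<close> by (intro continuous_intros cont) auto
    fix t assume t: "a < t" "t < b"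
    then have n: "\<phi> t \<noteq> 0" using nz by auto
    have "((\<lambda>t. 1 / (\<phi> t)\<^sup>2 + 2 * k * t) has_real_derivative 2 * k - 2 * \<psi> t / \<phi> t ^ 3) (at t)"
      by (rule derivative_eq_intros \<phi>[OF t] refl | use n in \<open>simp add: power2_eq_square power3_eq_cube\<close>)+
    moreover have "2 * k - 2 * \<psi> t / \<phi> t ^ 3 = 0"
      using n k[of t] t by simp
    ultimately show "((\<lambda>t. 1 / (\<phi> t)\<^sup>2 + 2 * k * t) has_real_derivative 0) (at t)"
      by simp
  qed
  have pos: "\<phi> a * \<phi> b > 0"
    using continuous_nonzero_same_sign[OF _ cont(2) nz(1)] \<open>a < b\<close> by simp
  then have n: "\<phi> a \<noteq> 0" "\<phi> b \<noteq> 0" "\<phi> b + \<phi> a \<noteq> 0"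
    by (auto simp: zero_less_mult_iff)
  have "u b - u a = (\<phi> b - \<phi> a) / (k * \<phi> a * \<phi> b)"
  proof -
    have "1 / (k * \<phi> a) - 1 / (k * \<phi> b) = (\<phi> b - \<phi> a) / (k * \<phi> a * \<phi> b)"
      using n \<open>k \<noteq> 0\<close> by (simp add: field_simps)
    then show ?thesis
      using E1 by linarith
  qed
  also have "b - a = ((\<phi> b)\<^sup>2 - (\<phi> a)\<^sup>2) / (2 * k * (\<phi> a)\<^sup>2 * (\<phi> b)\<^sup>2)"
    using E2 n \<open>k \<noteq> 0\<close> by (simp add: field_simps)
  then have "(b - a) * (2 * \<phi> b * \<phi> a / (\<phi> b + \<phi> a)) = (\<phi> b - \<phi> a) / (k * \<phi> a * \<phi> b)"
  proof -
    have "((\<phi> b)\<^sup>2 - (\<phi> a)\<^sup>2) = (\<phi> b - \<phi> a) * (\<phi> b + \<phi> a)"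
      by (simp add: algebra_simps power2_eq_square)
    then show ?thesis
      unfolding \<open>b - a = _\<close> using n \<open>k \<noteq> 0\<close> by (simp add: power2_eq_square)
  qed
  finally show ?thesis by simp
qed

section \<open>Implicit one-step methods\<close>

text \<open>\<open>U\<close> holds the exact values and \<tau> bounds the local error. Since
  \<open>q \<le> 1 / 4\<close>, one step multiplies the error by at most
  \<open>(1 + q) / (1 - q) \<le> 1 + 4 * q \<le> exp (4 * q)\<close> and adds at most
  \<open>\<tau> / (1 - q) \<le> 2 * \<tau>\<close>; \<open>E n\<close> is the resulting Gronwall
  bound after \<open>n\<close> steps.\<close>

lemma implicit_one_step_exists:
  fixes U :: "nat \<Rightarrow> real" and \<Phi> :: "nat \<Rightarrow> real \<Rightarrow> real \<Rightarrow> real" and q \<tau> \<rho> :: real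
  defines "E \<equiv> \<lambda>n. 2 * \<tau> * real n * exp (4 * q * real n)"
  assumes "0 \<le> q" "q \<le> 1 / 4" "0 \<le> \<tau>"
    and lip: "\<And>n x x' y y'. \<lbrakk>n < N; \<bar>y - U (Suc n)\<bar> \<le> \<rho>; \<bar>y' - U (Suc n)\<bar> \<le> \<rho>; \<bar>x - U n\<bar> \<le> \<rho>; \<bar>x' - U n\<bar> \<le> \<rho>\<rbrakk>
      \<Longrightarrow> \<bar>\<Phi> n y x - \<Phi> n y' x'\<bar> \<le> q * (\<bar>y - y'\<bar> + \<bar>x - x'\<bar>)"
    and consistent: "\<And>n. n < N \<Longrightarrow> \<bar>U (Suc n) - U n - \<Phi> n (U (Suc n)) (U n)\<bar> \<le> \<tau>"
    and small: "2 * E N + 2 * \<tau> \<le> \<rho>"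
  shows "\<exists>v. v 0 = U 0 \<and> (\<forall>n<N. v (Suc n) = v n + \<Phi> n (v (Suc n)) (v n)) \<and> (\<forall>n\<le>N. \<bar>v n - U n\<bar> \<le> E n)"
proof -
  have E_mono: "E n \<le> E N" if "n \<le> N" for n
    unfolding E_def using that assms(2,4) by (intro mult_mono) (auto intro: mult_left_mono)
  have E_nonneg: "0 \<le> E n" for n
    using assms(2,4) by (simp add: E_def)
  have step: "\<exists>y. \<bar>y - U (Suc n)\<bar> \<le> E (Suc n) \<and> y = x + \<Phi> n y x"
    if n: "n < N" and x: "\<bar>x - U n\<bar> \<le> E n" for n x
  proof -
    have \<rho>: "0 \<le> \<rho>" "E n \<le> \<rho>"
      using small E_mono[of n] E_nonneg[of N] E_nonneg[of n] \<open>0 \<le> \<tau>\<close> n by linarith+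
    have defect: "\<bar>x + \<Phi> n y x - U (Suc n)\<bar> \<le> (1 + q) * \<bar>x - U n\<bar> + q * \<bar>y - U (Suc n)\<bar> + \<tau>"
      if "\<bar>y - U (Suc n)\<bar> \<le> \<rho>" for y
    proof -
      have "\<bar>\<Phi> n y x - \<Phi> n (U (Suc n)) (U n)\<bar> \<le> q * (\<bar>y - U (Suc n)\<bar> + \<bar>x - U n\<bar>)"
        using that x n \<rho> by (intro lip) auto
      then show ?thesis
        using consistent[OF n] by (simp add: algebra_simps)
    qed
    \<comment> \<open>The contraction acts on the full ball of radius \<rho>, where
      \<open>lip\<close> is available. It maps the ball into itself because \<open>small\<close>
      leaves room for \<open>5 / 4 * E N + \<rho> / 4 + \<tau>\<close>.\<close>
    have "\<exists>!y\<in>cball (U (Suc n)) \<rho>. x + \<Phi> n y x = y"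
    proof (rule Banach_fix)
      show "(\<lambda>y. x + \<Phi> n y x) ` cball (U (Suc n)) \<rho> \<subseteq> cball (U (Suc n)) \<rho>"
      proof clarsimp
        fix y assume "dist (U (Suc n)) y \<le> \<rho>"
        then have y: "\<bar>y - U (Suc n)\<bar> \<le> \<rho>"
          by (simp add: dist_real_def abs_minus_commute)
        have "(1 + q) * \<bar>x - U n\<bar> \<le> 5 / 4 * E N"
          using x E_mono[of n] n \<open>0 \<le> q\<close> \<open>q \<le> 1 / 4\<close> by (intro mult_mono) auto
        moreover have "q * \<bar>y - U (Suc n)\<bar> \<le> 1 / 4 * \<rho>"
          using y \<open>0 \<le> q\<close> \<open>q \<le> 1 / 4\<close> by (intro mult_mono) auto
        moreover have "a + b + \<tau> \<le> \<rho>" if "a \<le> 5 / 4 * E N" "b \<le> 1 / 4 * \<rho>" for a b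
          using that small E_nonneg[of N] \<open>0 \<le> \<tau>\<close> \<rho> by linarith
        ultimately have "\<bar>x + \<Phi> n y x - U (Suc n)\<bar> \<le> \<rho>"
          using order_trans[OF defect[OF y]] by blast
        then show "dist (U (Suc n)) (x + \<Phi> n y x) \<le> \<rho>"
          by (simp add: dist_real_def abs_minus_commute)
      qed
      show "dist (x + \<Phi> n y x) (x + \<Phi> n z x) \<le> q * dist y z"
        if "y \<in> cball (U (Suc n)) \<rho>" "z \<in> cball (U (Suc n)) \<rho>" for y z
        using lip[of n y z x x] that n x \<rho> by (auto simp: dist_real_def abs_minus_commute)
    qed (use \<rho> assms in \<open>auto simp: complete_eq_closed\<close>)
    then obtain y where y: "\<bar>y - U (Suc n)\<bar> \<le> \<rho>" "x + \<Phi> n y x = y"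
      by (auto simp: dist_real_def abs_minus_commute)
    \<comment> \<open>The fixed point is so far only within \<rho>. Applying \<open>defect\<close>
      to it and absorbing its own error on the left improves this to
      \<open>E (Suc n)\<close>.\<close>
    have "(1 - q) * \<bar>y - U (Suc n)\<bar> \<le> (1 + q) * \<bar>x - U n\<bar> + \<tau>"
      using defect[OF y(1)] y(2) by (simp add: algebra_simps)
    also have "\<dots> \<le> (1 + q) * E n + \<tau>"
      using x \<open>0 \<le> q\<close> by (intro add_right_mono mult_left_mono) auto
    also have "\<dots> \<le> (1 - q) * ((1 + 4 * q) * E n + 2 * \<tau>)"
    proof -
      have "(1 - q) * ((1 + 4 * q) * E n + 2 * \<tau>) - ((1 + q) * E n + \<tau>) = 2 * q * (1 - 2 * q) * E n + (1 - 2 * q) * \<tau>"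
        by (simp add: algebra_simps)
      moreover have "\<dots> \<ge> 0"
        using assms(2-4) E_nonneg[of n] by (intro add_nonneg_nonneg mult_nonneg_nonneg) auto
      ultimately show ?thesis by linarith
    qed
    finally have "\<bar>y - U (Suc n)\<bar> \<le> (1 + 4 * q) * E n + 2 * \<tau>"
      using \<open>q \<le> 1 / 4\<close> by simp
    also have "\<dots> \<le> exp (4 * q) * E n + 2 * \<tau> * exp (4 * q * real (Suc n))"
      using exp_ge_add_one_self[of "4 * q"] E_nonneg[of n] assms(2,4)
      by (intro add_mono mult_right_mono) (auto simp: mult_le_cancel_left1)
    also have "\<dots> = E (Suc n)"
      by (simp add: E_def algebra_simps exp_add)
    finally show ?thesis
      using y(2) by auto
  qed
  \<comment> \<open>Dependent choice runs over all naturals; the guards with \<open>N\<close> leave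
    the entries beyond \<open>N\<close> unconstrained.\<close>
  have "\<exists>v. \<forall>n. (n \<le> N \<longrightarrow> \<bar>v n - U n\<bar> \<le> E n) \<and> (n = 0 \<longrightarrow> v n = U 0) \<and>
      (n < N \<longrightarrow> v (Suc n) = v n + \<Phi> n (v (Suc n)) (v n))"
    using dependent_nat_choice[of "\<lambda>n x. (n \<le> N \<longrightarrow> \<bar>x - U n\<bar> \<le> E n) \<and> (n = 0 \<longrightarrow> x = U 0)"
        "\<lambda>n x y. n < N \<longrightarrow> y = x + \<Phi> n y x"] step E_nonneg
    by (simp add: Suc_le_eq) (metis abs_zero diff_self less_imp_le)
  then show ?thesis by blast
qed

text \<open>If two solutions agree at \<open>n\<close>, their next values are fixed points of the
  same contraction.\<close>

lemma implicit_one_step_unique: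
  fixes U :: "nat \<Rightarrow> real" and \<Phi> :: "nat \<Rightarrow> real \<Rightarrow> real \<Rightarrow> real"
  assumes "q < 1"
    and lip: "\<And>n x y y'. \<lbrakk>n < N; \<bar>y - U (Suc n)\<bar> \<le> \<rho>; \<bar>y' - U (Suc n)\<bar> \<le> \<rho>; \<bar>x - U n\<bar> \<le> \<rho>\<rbrakk>
      \<Longrightarrow> \<bar>\<Phi> n y x - \<Phi> n y' x\<bar> \<le> q * \<bar>y - y'\<bar>"
    and v: "\<And>n. n < N \<Longrightarrow> v (Suc n) = v n + \<Phi> n (v (Suc n)) (v n)" "\<And>n. n \<le> N \<Longrightarrow> \<bar>v n - U n\<bar> \<le> \<rho>"
    and w: "\<And>n. n < N \<Longrightarrow> w (Suc n) = w n + \<Phi> n (w (Suc n)) (w n)" "\<And>n. n \<le> N \<Longrightarrow> \<bar>w n - U n\<bar> \<le> \<rho>"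
    and "w 0 = v 0" and "n \<le> N"
  shows "w n = v n"
  using \<open>n \<le> N\<close>
proof (induction n)
  case 0
  then show ?case by (simp add: \<open>w 0 = v 0\<close>)
next
  case (Suc n)
  then have "\<bar>\<Phi> n (w (Suc n)) (v n) - \<Phi> n (v (Suc n)) (v n)\<bar> \<le> q * \<bar>w (Suc n) - v (Suc n)\<bar>"
    by (intro lip v w) auto
  then have "(1 - q) * \<bar>w (Suc n) - v (Suc n)\<bar> \<le> 0"
    using v(1)[of n] w(1)[of n] Suc by (simp add: algebra_simps)
  then show ?case
    using \<open>q < 1\<close> by (simp add: mult_le_0_iff)
qed

section \<open>Convergence of the scheme\<close>

theorem theorem5p9:
  fixes \<Omega> :: "(real \<times> real) set"
    and F :: "real \<times> real \<Rightarrow> real"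
    and t0 T u0 \<rho> L C \<epsilon> :: real
    and u :: "real \<Rightarrow> real"
    and \<sigma> :: "real \<Rightarrow> nat \<Rightarrow> real"
  assumes "open \<Omega>" and "0 \<le> t0" and "t0 < T" and "(t0, u0) \<in> \<Omega>"
    and "C_k_on 2 \<Omega> F"
    and "C_k_interval 4 t0 T u"
    and "ivp_solution \<Omega> F t0 T u0 u"
    and "\<forall>v. ivp_solution \<Omega> F t0 T u0 v \<longrightarrow> (\<forall>t\<in>{t0..T}. v t = u t)"
    and "\<rho> > 0" and "L \<ge> 0" and "tube t0 T \<rho> u \<subseteq> \<Omega>"
    and "\<forall>t x y. (t, x) \<in> tube t0 T \<rho> u \<and> (t, y) \<in> tube t0 T \<rho> u \<longrightarrow>
           \<bar>F (t, x) - F (t, y)\<bar> \<le> L * \<bar>x - y\<bar>"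
    and "\<forall>t\<in>{t0..T}. F (t, u t) * lie_deriv F F (t, u t) \<noteq> 0"
    and "\<forall>t\<in>{t0..T}. 3 * (lie_deriv F F (t, u t))\<^sup>2 =
           F (t, u t) * lie_deriv F (lie_deriv F F) (t, u t)"
    and "C > 0" and "\<epsilon> > 0"
    and "\<forall>h\<in>{0<..\<epsilon>}. \<forall>n<num_steps t0 T h. 0 < \<sigma> h n \<and> \<sigma> h n \<le> C * sqrt h"
  shows "\<exists>H C\<^sub>g. 0 < H \<and> H \<le> \<epsilon> \<and> 0 < C\<^sub>g \<and>
    (\<forall>h\<in>{0<..H}. \<exists>v.
       (scheme_solution F t0 T h (\<sigma> h) (u t0) v \<and>
        (\<forall>n\<le>num_steps t0 T h. (grid t0 h n, v n) \<in> tube t0 T \<rho> u)) \<and>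
       (\<forall>w. scheme_solution F t0 T h (\<sigma> h) (u t0) w \<and>
            (\<forall>n\<le>num_steps t0 T h. (grid t0 h n, w n) \<in> tube t0 T \<rho> u) \<longrightarrow>
            (\<forall>n\<le>num_steps t0 T h. w n = v n)) \<and>
       Max ((\<lambda>n. \<bar>u (grid t0 h n) - v n\<bar>) ` {0..num_steps t0 T h}) \<le> C\<^sub>g * h ^ 3)"
proof -
  note Lip = assms(12) and scales = assms(17)
  define \<phi> where "\<phi> t = F (t, u t)" for t
  define \<psi> where "\<psi> t = lie_deriv F F (t, u t)" for t
  define \<zeta> where "\<zeta> t = lie_deriv F (lie_deriv F F) (t, u t)" for t
  have F1: "C_k_on 1 \<Omega> F"
    using \<open>C_k_on 2 \<Omega> F\<close> by (auto simp: numeral_2_eq_2)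
  note LF1 = C_1_on_lie_deriv[OF \<open>C_k_on 2 \<Omega> F\<close>]
  have u: "continuous_on {t0..T} u" "\<And>t. t \<in> {t0..T} \<Longrightarrow> (t, u t) \<in> \<Omega>"
    and u': "\<And>t. t0 < t \<Longrightarrow> t < T \<Longrightarrow> (u has_real_derivative \<phi> t) (at t)"
    using \<open>ivp_solution \<Omega> F t0 T u0 u\<close> by (auto simp: ivp_solution_def \<phi>_def)
  have curve: "continuous_on {t0..T} (\<lambda>t. (t, u t))" "(\<lambda>t. (t, u t)) ` {t0..T} \<subseteq> \<Omega>"
    using u by (auto intro!: continuous_intros)
  have cont: "continuous_on {t0..T} \<phi>" "continuous_on {t0..T} \<psi>"
    unfolding \<phi>_def \<psi>_def using F1 LF1
    by (auto intro!: continuous_on_compose2[OF _ curve(1) curve(2)])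
  \<comment> \<open>The slope of \<open>u\<close> is \<open>F\<close> along the curve, so the chain
    rule produces exactly the Lie derivative.\<close>
  have \<phi>': "(\<phi> has_real_derivative \<psi> t) (at t)" and \<psi>': "(\<psi> has_real_derivative \<zeta> t) (at t)"
    if "t0 < t" "t < T" for t
    using C_1_on_derivative_along_curve[OF \<open>open \<Omega>\<close> F1 _ u'[OF that]]
      C_1_on_derivative_along_curve[OF \<open>open \<Omega>\<close> LF1 _ u'[OF that]] u(2)[of t] that
    unfolding \<phi>_def \<psi>_def \<zeta>_def by (simp_all add: lie_deriv_def)
  have nz: "\<phi> t \<noteq> 0" "\<psi> t \<noteq> 0" if "t \<in> {t0..T}" for t
    using assms(13) that by (auto simp: \<phi>_def \<psi>_def)
  have order3: "3 * (\<psi> t)\<^sup>2 = \<phi> t * \<zeta> t" if "t \<in> {t0..T}" for t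
    using assms(14) that by (auto simp: \<phi>_def \<psi>_def \<zeta>_def)
  obtain m where m: "m > 0" "\<And>t. t \<in> {t0..T} \<Longrightarrow> m \<le> \<bar>\<phi> t\<bar>"
  proof -
    obtain s where "s \<in> {t0..T}" "\<forall>t\<in>{t0..T}. \<bar>\<phi> s\<bar> \<le> \<bar>\<phi> t\<bar>"
      using continuous_attains_inf[OF compact_Icc _ continuous_on_rabs[OF cont(1)]] \<open>t0 < T\<close> by auto
    then show thesis
      using nz by (intro that[of "\<bar>\<phi> s\<bar>"]) auto
  qed
  obtain D where D: "\<And>t. t \<in> {t0..T} \<Longrightarrow> \<bar>\<psi> t\<bar> \<le> D"
  proof -
    obtain s where "s \<in> {t0..T}" "\<forall>t\<in>{t0..T}. \<bar>\<psi> t\<bar> \<le> \<bar>\<psi> s\<bar>"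
      using continuous_attains_sup[OF compact_Icc _ continuous_on_rabs[OF cont(2)]] \<open>t0 < T\<close> by auto
    then show thesis
      by (intro that[of "\<bar>\<psi> s\<bar>"]) auto
  qed
  \<comment> \<open>Collects the local error with \<open>h = b - a\<close>:
    \<open>s\<^sup>2 \<le> C\<^sup>2 * h\<close> from the scale,
    \<open>D\<^sup>2 * h\<^sup>2\<close> from the increment of \<phi>, \<open>4 * m ^ 3\<close> from
    the comparison with the harmonic mean. The step length supplies the fourth power of
    \<open>h\<close>.\<close>
  define K where "K = C\<^sup>2 * D\<^sup>2 / (4 * m ^ 3)"
  have "K \<ge> 0"
    using m(1) by (simp add: K_def)
  have consistent: "\<bar>u b - u a - (b - a) * scaled_circ_mean s (\<phi> b) (\<phi> a)\<bar> \<le> K * (b - a) ^ 4"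
    if ab: "t0 \<le> a" "a < b" "b \<le> T" and s: "0 < s" "s \<le> C * sqrt (b - a)" for a b s
  proof -
    have sub: "{a..b} \<subseteq> {t0..T}"
      using ab by auto
    have "\<phi> a * \<phi> b > 0"
      by (rule continuous_nonzero_same_sign[OF _ continuous_on_subset[OF cont(1) sub]])
        (use ab nz in auto)
    then have pos: "\<phi> b * \<phi> a > 0"
      by (simp add: mult.commute)
    have "u b - u a = (b - a) * (2 * \<phi> b * \<phi> a / (\<phi> b + \<phi> a))"
      by (rule harmonic_mean_step_exact[where \<psi> = \<psi> and \<zeta> = \<zeta>])
        (use ab nz u' \<phi>' \<psi>' order3 in \<open>auto intro: continuous_on_subset[OF _ sub] u(1) cont\<close>)
    then have "\<bar>u b - u a - (b - a) * scaled_circ_mean s (\<phi> b) (\<phi> a)\<bar> =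
        \<bar>(b - a) * (2 * \<phi> b * \<phi> a / (\<phi> b + \<phi> a) - scaled_circ_mean s (\<phi> b) (\<phi> a))\<bar>"
      by (simp only: right_diff_distrib)
    also have "\<dots> = (b - a) * \<bar>scaled_circ_mean s (\<phi> b) (\<phi> a) - 2 * \<phi> b * \<phi> a / (\<phi> b + \<phi> a)\<bar>"
      using ab by (simp add: abs_mult abs_minus_commute)
    also have "\<dots> \<le> (b - a) * (s\<^sup>2 * (\<phi> b - \<phi> a)\<^sup>2 / (4 * m ^ 3))"
      using ab s m pos by (intro mult_left_mono scaled_circ_mean_harmonic_mean) auto
    also have "\<dots> \<le> (b - a) * ((C\<^sup>2 * (b - a)) * (D * (b - a))\<^sup>2 / (4 * m ^ 3))"
    proof -
      have "s\<^sup>2 \<le> (C * sqrt (b - a))\<^sup>2"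
        using s by (intro power_mono) auto
      also have "\<dots> = C\<^sup>2 * (b - a)"
        using ab by (simp add: power_mult_distrib)
      finally have s2: "s\<^sup>2 \<le> C\<^sup>2 * (b - a)" .
      obtain l z where z: "a < z" "z < b" "(\<phi> has_real_derivative l) (at z)" "\<phi> b - \<phi> a = (b - a) * l"
      proof -
        have "\<phi> differentiable at x" if "a < x" "x < b" for x
          using \<phi>'[of x] that ab by (auto simp: real_differentiable_def)
        then show thesis
          using MVT[OF \<open>a < b\<close> continuous_on_subset[OF cont(1) sub]] that by blast
      qed
      then have "l = \<psi> z"
        using DERIV_unique[OF z(3) \<phi>'] ab by auto
      then have "\<bar>\<phi> b - \<phi> a\<bar> = (b - a) * \<bar>\<psi> z\<bar>"
        using z(4) ab by (simp add: abs_mult)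
      also have "\<dots> \<le> (b - a) * D"
        using ab z by (intro mult_left_mono D) auto
      finally have "(\<phi> b - \<phi> a)\<^sup>2 \<le> (D * (b - a))\<^sup>2"
        by (metis abs_ge_zero mult.commute power2_abs power_mono)
      with s2 show ?thesis
        using ab m(1) by (intro mult_left_mono divide_right_mono mult_mono) auto
    qed
    also have "\<dots> = K * (b - a) ^ 4"
      by (simp add: K_def power_mult_distrib power2_eq_square eval_nat_numeral)
    finally show ?thesis .
  qed
  \<comment> \<open>The Gronwall bound for \<open>q = 2 * L * h\<close> and
    \<open>\<tau> = K * h ^ 4\<close>, divided by \<open>h ^ 3\<close>, after \<open>n * h\<close>
    is replaced by its upper bound \<open>T - t0\<close>.\<close>
  define M where "M = 2 * K * (T - t0) * exp (8 * L * (T - t0))"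
  have "M \<ge> 0"
    using \<open>K \<ge> 0\<close> \<open>t0 < T\<close> by (simp add: M_def)
  \<comment> \<open>In order: the scales are given, powers of \<open>h\<close> are at most
    \<open>h\<close>, \<open>2 * L * h \<le> 1 / 4\<close>, and the error bounds fit into the tube.
    The added ones keep the denominators positive.\<close>
  define H where "H = Min {\<epsilon>, 1, 1 / (8 * L + 1), \<rho> / (2 * M + 2 * K + 1)}"
  have "H > 0" "H \<le> \<epsilon>"
    using \<open>\<epsilon> > 0\<close> \<open>\<rho> > 0\<close> \<open>L \<ge> 0\<close> \<open>M \<ge> 0\<close> \<open>K \<ge> 0\<close> by (simp_all add: H_def)
  have "\<exists>v. (scheme_solution F t0 T h (\<sigma> h) (u t0) v \<and>
        (\<forall>n\<le>num_steps t0 T h. (grid t0 h n, v n) \<in> tube t0 T \<rho> u)) \<and>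
       (\<forall>w. scheme_solution F t0 T h (\<sigma> h) (u t0) w \<and>
            (\<forall>n\<le>num_steps t0 T h. (grid t0 h n, w n) \<in> tube t0 T \<rho> u) \<longrightarrow>
            (\<forall>n\<le>num_steps t0 T h. w n = v n)) \<and>
       Max ((\<lambda>n. \<bar>u (grid t0 h n) - v n\<bar>) ` {0..num_steps t0 T h}) \<le> (M + 1) * h ^ 3"
    if "h \<in> {0<..H}" for h
  proof -
    have h: "0 < h" "h \<le> \<epsilon>" "h \<le> 1" "8 * L * h \<le> 1" "(2 * M + 2 * K) * h \<le> \<rho>"
    proof -
      have "h \<le> \<epsilon>" "h \<le> 1" "h \<le> 1 / (8 * L + 1)" "h \<le> \<rho> / (2 * M + 2 * K + 1)"
        using that by (auto simp: H_def)
      moreover from this have "h * (8 * L + 1) \<le> 1" "h * (2 * M + 2 * K + 1) \<le> \<rho>"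
        using \<open>L \<ge> 0\<close> \<open>M \<ge> 0\<close> \<open>K \<ge> 0\<close> by (simp_all add: pos_le_divide_eq add_nonneg_pos)
      moreover show "0 < h"
        using that by simp
      ultimately show "h \<le> \<epsilon>" "h \<le> 1" "8 * L * h \<le> 1" "(2 * M + 2 * K) * h \<le> \<rho>"
        by (simp_all add: algebra_simps)
    qed
    define N where "N = num_steps t0 T h"
    define t where "t = grid t0 h"
    define \<Phi> where "\<Phi> n y x = h * scaled_circ_mean (\<sigma> h n) (F (t (Suc n), y)) (F (t n, x))" for n y x
    have t_Suc: "t (Suc n) = t n + h" for n
      by (simp add: t_def grid_def algebra_simps)
    have N: "real N * h \<le> T - t0"
    proof -
      have "real N \<le> inverse h * (T - t0)"
        using h \<open>t0 < T\<close> by (simp add: N_def num_steps_def)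
      then show ?thesis
        using h by (simp add: field_simps)
    qed
    have t: "t n \<in> {t0..T}" if "n \<le> N" for n
    proof -
      have "real n * h \<le> T - t0"
        by (rule order_trans[OF mult_right_mono N]) (use that h in auto)
      moreover have "0 \<le> real n * h"
        using h by simp
      ultimately show ?thesis
        by (simp add: t_def grid_def)
    qed
    have tube_iff: "(t n, x) \<in> tube t0 T \<rho> u \<longleftrightarrow> \<bar>x - u (t n)\<bar> \<le> \<rho>" if "n \<le> N" for n x
      using t[OF that] by (simp add: tube_def)
    have scale: "0 < \<sigma> h n" "\<sigma> h n \<le> C * sqrt h" if "n < N" for n
      using scales h that by (auto simp: N_def)
    have lip: "\<bar>\<Phi> n y x - \<Phi> n y' x'\<bar> \<le> (2 * L * h) * (\<bar>y - y'\<bar> + \<bar>x - x'\<bar>)"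
      if n: "n < N" and yx: "\<bar>y - u (t (Suc n))\<bar> \<le> \<rho>" "\<bar>y' - u (t (Suc n))\<bar> \<le> \<rho>" "\<bar>x - u (t n)\<bar> \<le> \<rho>" "\<bar>x' - u (t n)\<bar> \<le> \<rho>"
      for n x x' y y'
    proof -
      have "\<bar>F (t (Suc n), y) - F (t (Suc n), y')\<bar> \<le> L * \<bar>y - y'\<bar>" "\<bar>F (t n, x) - F (t n, x')\<bar> \<le> L * \<bar>x - x'\<bar>"
        using Lip n yx tube_iff[of n] tube_iff[of "Suc n"] by auto
      then have "\<bar>scaled_circ_mean (\<sigma> h n) (F (t (Suc n), y)) (F (t n, x)) -
          scaled_circ_mean (\<sigma> h n) (F (t (Suc n), y')) (F (t n, x'))\<bar> \<le> 2 * L * (\<bar>y - y'\<bar> + \<bar>x - x'\<bar>)"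
        by (intro order_trans[OF scaled_circ_mean_lipschitz[OF scale(1)[OF n]]]) (simp add: algebra_simps)
      then have "h * \<bar>scaled_circ_mean (\<sigma> h n) (F (t (Suc n), y)) (F (t n, x)) -
          scaled_circ_mean (\<sigma> h n) (F (t (Suc n), y')) (F (t n, x'))\<bar> \<le> h * (2 * L * (\<bar>y - y'\<bar> + \<bar>x - x'\<bar>))"
        using h by (intro mult_left_mono) auto
      moreover have "\<Phi> n y x - \<Phi> n y' x' = h * (scaled_circ_mean (\<sigma> h n) (F (t (Suc n), y)) (F (t n, x)) -
          scaled_circ_mean (\<sigma> h n) (F (t (Suc n), y')) (F (t n, x')))"
        by (simp add: \<Phi>_def right_diff_distrib)
      ultimately show ?thesis
        using h by (simp add: abs_mult mult_ac)
    qed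
    have defect: "\<bar>u (t (Suc n)) - u (t n) - \<Phi> n (u (t (Suc n))) (u (t n))\<bar> \<le> K * h ^ 4" if "n < N" for n
      using consistent[of "t n" "t (Suc n)" "\<sigma> h n"] t[of n] t[of "Suc n"] scale[OF that] that h
      by (simp add: \<Phi>_def \<phi>_def t_Suc)
    define E where "E n = 2 * (K * h ^ 4) * real n * exp (4 * (2 * L * h) * real n)" for n
    have E: "E n \<le> M * h ^ 3" if "n \<le> N" for n
    proof -
      have n: "real n * h \<le> T - t0"
        using t[OF that] by (simp add: t_def grid_def)
      \<comment> \<open>One of the four powers of \<open>h\<close> is spent on
        \<open>real n * h\<close>, which leaves order three.\<close>
      have "E n = 2 * K * (real n * h) * exp (8 * L * (real n * h)) * h ^ 3"
        by (simp add: E_def eval_nat_numeral mult_ac)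
      also have "\<dots> \<le> 2 * K * (T - t0) * exp (8 * L * (T - t0)) * h ^ 3"
        using n h \<open>K \<ge> 0\<close> \<open>L \<ge> 0\<close> \<open>t0 < T\<close>
        by (intro mult_right_mono mult_mono mult_left_mono) (auto intro!: mult_left_mono)
      finally show ?thesis
        by (simp add: M_def)
    qed
    have pow: "h ^ 3 \<le> h" "h ^ 4 \<le> h"
      using h power_decreasing[of 1 3 h] power_decreasing[of 1 4 h] by simp_all
    have small: "2 * E N + 2 * (K * h ^ 4) \<le> \<rho>"
    proof -
      have "M * h ^ 3 \<le> M * h" "K * h ^ 4 \<le> K * h"
        using pow \<open>M \<ge> 0\<close> \<open>K \<ge> 0\<close> by (auto intro: mult_left_mono)
      then show ?thesis
        using E[of N] h(5) by (simp add: algebra_simps)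
    qed
    have "\<exists>v. v 0 = u (t 0) \<and> (\<forall>n<N. v (Suc n) = v n + \<Phi> n (v (Suc n)) (v n)) \<and>
        (\<forall>n\<le>N. \<bar>v n - u (t n)\<bar> \<le> E n)"
      unfolding E_def
    proof (rule implicit_one_step_exists[where \<rho> = \<rho> and U = "\<lambda>n. u (t n)"])
      show "0 \<le> 2 * L * h" "2 * L * h \<le> 1 / 4" "0 \<le> K * h ^ 4"
        using h \<open>L \<ge> 0\<close> \<open>K \<ge> 0\<close> by auto
      show "2 * (2 * (K * h ^ 4) * real N * exp (4 * (2 * L * h) * real N)) + 2 * (K * h ^ 4) \<le> \<rho>"
        using small by (simp add: E_def)
    qed (use lip defect in auto)
    then obtain v where v: "v 0 = u (t 0)" "\<And>n. n < N \<Longrightarrow> v (Suc n) = v n + \<Phi> n (v (Suc n)) (v n)"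
      "\<And>n. n \<le> N \<Longrightarrow> \<bar>v n - u (t n)\<bar> \<le> E n"
      by blast
    have t_0: "t 0 = t0"
      by (simp add: t_def grid_def)
    have err: "\<bar>v n - u (t n)\<bar> \<le> M * h ^ 3" if "n \<le> N" for n
      using v(3) E that by (meson order_trans)
    have "M * h ^ 3 \<le> \<rho>"
    proof -
      have "M * h ^ 3 \<le> M * h" "0 \<le> M * h" "0 \<le> K * h"
        using pow h \<open>M \<ge> 0\<close> \<open>K \<ge> 0\<close> by (auto intro: mult_left_mono)
      then show ?thesis
        using h(5) unfolding distrib_right by linarith
    qed
    then have v_tube: "\<bar>v n - u (t n)\<bar> \<le> \<rho>" if "n \<le> N" for n
      using err[OF that] by linarith
    have scheme_iff: "scheme_solution F t0 T h (\<sigma> h) (u t0) w \<longleftrightarrow>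
        w 0 = v 0 \<and> (\<forall>n<N. w (Suc n) = w n + \<Phi> n (w (Suc n)) (w n))" for w
      by (simp add: scheme_solution_def \<Phi>_def t_def[symmetric] N_def v(1) t_0)
    have uniq: "w n = v n" if "scheme_solution F t0 T h (\<sigma> h) (u t0) w"
      "\<forall>n\<le>N. (t n, w n) \<in> tube t0 T \<rho> u" "n \<le> N" for w n
    proof (rule implicit_one_step_unique[where q = "2 * L * h" and U = "\<lambda>n. u (t n)" and N = N and \<Phi> = \<Phi> and \<rho> = \<rho>])
      show "2 * L * h < 1"
        using h by linarith
      show "\<bar>\<Phi> k y x - \<Phi> k y' x\<bar> \<le> 2 * L * h * \<bar>y - y'\<bar>"
        if "k < N" "\<bar>y - u (t (Suc k))\<bar> \<le> \<rho>" "\<bar>y' - u (t (Suc k))\<bar> \<le> \<rho>" "\<bar>x - u (t k)\<bar> \<le> \<rho>" for k x y y'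
        using lip[OF that that(4)] by simp
    qed (use that v v_tube scheme_iff tube_iff in auto)
    have "Max ((\<lambda>n. \<bar>u (t n) - v n\<bar>) ` {0..N}) \<le> M * h ^ 3"
      using err by (simp add: abs_minus_commute)
    \<comment> \<open>Only \<open>M \<ge> 0\<close> is established, while the error constant has to
      be positive.\<close>
    also have "\<dots> \<le> (M + 1) * h ^ 3"
      using h by (simp add: distrib_right)
    finally have max: "Max ((\<lambda>n. \<bar>u (t n) - v n\<bar>) ` {0..N}) \<le> (M + 1) * h ^ 3" .
    show ?thesis
      unfolding N_def[symmetric] t_def[symmetric]
      using max uniq v v_tube tube_iff scheme_iff by (intro exI[of _ v]) auto
  qed
  then show ?thesis
    using \<open>H > 0\<close> \<open>H \<le> \<epsilon>\<close> \<open>M \<ge> 0\<close> by (intro exI[of _ H] exI[of _ "M + 1"]) auto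
qed

end
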